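(* For every $\alpha>0$ there exist $x_\alpha^{+}$ and $x_\alpha^{-}$ in $\mathcal{M}_\alpha$ such that $\psi(x_\alpha^{+})=D^{+}F(\alpha)$ and $\psi(x_\alpha^{-})=D^{-}F(\alpha)$.
   Context: Let $X,Y$ be Banach spaces, $Q_{\mathrm{ad}}\subset X$ a nonempty admissible set, $y^\delta\in Y$ fixed data, and let $\varphi(\cdot,y^\delta):Q_{\mathrm{ad}}\to[0,\infty)$ (fidelity functional) and $\psi:Q_{\mathrm{ad}}\to[0,\infty)$ (regularization functional) be given. For $\alpha>0$ put $J_\alpha(x)=\varphi(x,y^\delta)+\alpha\psi(x)$, and define the minimum value function $F(\alpha)=\inf_{x\in Q_{\mathrm{ad}}}J_\alpha(x)$. Let $\mathcal{M}_\alpha=\{x\in Q_{\mathrm{ad}}: J_\alpha(x)=F(\alpha)\}$ be the set of minimizers; it is assumed that $\mathcal{M}_\alpha\neq\emptyset$ for every $\alpha>0$. The one-sided derivatives are denoted (note the convention: $D^+$ is the derivative from the left, $D^-$ the derivative from the right) \[ D^{+}F(\alpha)=\lim_{h\downarrow 0}\frac{F(\alpha)-F(\alpha-h)}{h},\qquad D^{-}F(\alpha)=\lim_{h\downarrow 0}\frac{F(\alpha+h)-F(\alpha)}{h}; \] both limits exist for every $\alpha>0$ because $F$ is concave. A sequence $\{x_n\}\subset Q_{\mathrm{ad}}$ is called $\psi$-bounded if there is a constant $M>0$ with $\sup_n\psi(x_n)<M$. Standing assumptions: (1) every $\psi$-bounded sequence in $Q_{\mathrm{ad}}$ has a subsequence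 converging weakly in $X$ to an element of $Q_{\mathrm{ad}}$; (2) $\varphi(\cdot,y^\delta)$ and $\psi$ are weakly sequentially lower semicontinuous: if $\{x_n\}\subset Q_{\mathrm{ad}}$ converges weakly to $x^*\in Q_{\mathrm{ad}}$, then $\varphi(x^*,y^\delta)\le\liminf_{n\to\infty}\varphi(x_n,y^\delta)$ and $\psi(x^* )\le\liminf_{n\to\infty}\psi(x_n)$. *)

theory Defs
  imports "HOL-Analysis.Analysis"
begin

definition weakly_converges :: "(nat \<Rightarrow> 'a::real_normed_vector) \<Rightarrow> 'a \<Rightarrow> bool" where
  "weakly_converges x l \<longleftrightarrow>
     (\<forall>f :: 'a \<Rightarrow> real. bounded_linear f \<longrightarrow> (\<lambda>n. f (x n)) \<longlonglongrightarrow> f l)"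

definition wslsc_on :: "'a::real_normed_vector set \<Rightarrow> ('a \<Rightarrow> real) \<Rightarrow> bool" where
  "wslsc_on Q g \<longleftrightarrow>
     (\<forall>x l. (\<forall>n. x n \<in> Q) \<and> l \<in> Q \<and> weakly_converges x l \<longrightarrow>
        ereal (g l) \<le> liminf (\<lambda>n. ereal (g (x n))))"

(* The supremum is taken in the extended reals, since an unbounded set of reals has no
   meaningful Sup. *)
definition psi_bounded :: "('a \<Rightarrow> real) \<Rightarrow> (nat \<Rightarrow> 'a) \<Rightarrow> bool" where
  "psi_bounded \<psi> x \<longleftrightarrow> (\<exists>M::real. M > 0 \<and> (SUP n. ereal (\<psi> (x n))) < ereal M)"

definition objective ::
  "('a \<Rightarrow> 'b \<Rightarrow> real) \<Rightarrow> ('a \<Rightarrow> real) \<Rightarrow> 'b \<Rightarrow> real \<Rightarrow> 'a \<Rightarrow> real" where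
  "objective \<phi> \<psi> y \<alpha> x = \<phi> x y + \<alpha> * \<psi> x"

definition min_value ::
  "'a set \<Rightarrow> ('a \<Rightarrow> 'b \<Rightarrow> real) \<Rightarrow> ('a \<Rightarrow> real) \<Rightarrow> 'b \<Rightarrow> real \<Rightarrow> real" where
  "min_value Q \<phi> \<psi> y \<alpha> = (INF x\<in>Q. objective \<phi> \<psi> y \<alpha> x)"

definition minimizers ::
  "'a set \<Rightarrow> ('a \<Rightarrow> 'b \<Rightarrow> real) \<Rightarrow> ('a \<Rightarrow> real) \<Rightarrow> 'b \<Rightarrow> real \<Rightarrow> 'a set" where
  "minimizers Q \<phi> \<psi> y \<alpha> = {x \<in> Q. objective \<phi> \<psi> y \<alpha> x = min_value Q \<phi> \<psi> y \<alpha>}"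

(* Convention: the superscript + denotes the derivative from the left, - the one from the
   right. Lim is unspecified where the limit does not exist; for the minimum value
   function both limits exist, see D_plus_min_value and D_minus_min_value below. *)
definition D_plus :: "(real \<Rightarrow> real) \<Rightarrow> real \<Rightarrow> real" where
  "D_plus F \<alpha> = Lim (at_right 0) (\<lambda>h. (F \<alpha> - F (\<alpha> - h)) / h)"

definition D_minus :: "(real \<Rightarrow> real) \<Rightarrow> real \<Rightarrow> real" where
  "D_minus F \<alpha> = Lim (at_right 0) (\<lambda>h. (F (\<alpha> + h) - F \<alpha>) / h)"

lemma concave_on_min_value:
  assumes "Q \<noteq> {}" "\<And>x. x \<in> Q \<Longrightarrow> \<phi> x y \<ge> 0" "\<And>x. x \<in> Q \<Longrightarrow> \<psi> x \<ge> 0"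
  shows "concave_on {0<..} (min_value Q \<phi> \<psi> y)"
proof -
  have bdd: "bdd_below (objective \<phi> \<psi> y a ` Q)" if "a > 0" for a
    using assms that by (intro bdd_belowI2[where m = 0]) (auto simp: objective_def)
  have le: "min_value Q \<phi> \<psi> y a \<le> objective \<phi> \<psi> y a x" if "a > 0" "x \<in> Q" for a x
    unfolding min_value_def using bdd that by (intro cINF_lower) auto
  have "u * min_value Q \<phi> \<psi> y a + v * min_value Q \<phi> \<psi> y b \<le> min_value Q \<phi> \<psi> y (u * a + v * b)"
    if ab: "a > 0" "b > 0" and uv: "u \<ge> 0" "v \<ge> 0" "u + v = 1" for a b u v
  proof (unfold min_value_def[of _ _ _ _ "u * a + v * b"], rule cINF_greatest[OF assms(1)])
    fix x assume x: "x \<in> Q"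
    have "u * min_value Q \<phi> \<psi> y a + v * min_value Q \<phi> \<psi> y b
        \<le> u * objective \<phi> \<psi> y a x + v * objective \<phi> \<psi> y b x"
      using le x ab uv by (intro add_mono mult_left_mono) auto
    also have "\<dots> = (u + v) * \<phi> x y + (u * a + v * b) * \<psi> x"
      by (simp add: objective_def algebra_simps)
    finally show "u * min_value Q \<phi> \<psi> y a + v * min_value Q \<phi> \<psi> y b
        \<le> objective \<phi> \<psi> y (u * a + v * b) x"
      using uv by (simp add: objective_def)
  qed
  then show ?thesis
    by (auto simp: concave_on_iff convex_real_interval)
qed

lemma concave_on_right_quotient:
  fixes f :: "real \<Rightarrow> real"
  assumes f: "concave_on {-b<..<b} f" and b: "b > 0"
  shows "\<exists>L. ((\<lambda>h. (f h - f 0) / h) \<longlongrightarrow> L) (at_right 0)"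
proof -
  define q where "q h = (f h - f 0) / h" for h
  have cv: "u * f s + v * f t \<le> f (u * s + v * t)"
    if "s \<in> {-b<..<b}" "t \<in> {-b<..<b}" "u \<ge> 0" "v \<ge> 0" "u + v = 1" for s t u v
    using f that by (auto simp: concave_on_iff)
  have anti: "q k \<le> q h" if hk: "0 < h" "h \<le> k" "k < b" for h k
  proof -
    have "(h / k) * f k + (1 - h / k) * f 0 \<le> f ((h / k) * k + (1 - h / k) * 0)"
      using hk by (intro cv) auto
    then have "(h / k) * (f k - f 0) \<le> f h - f 0"
      using hk by (simp add: algebra_simps)
    then show ?thesis
      using hk by (simp add: q_def field_simps)
  qed
  have bnd: "q h \<le> (f 0 - f (- (b / 2))) / (b / 2)" if h: "0 < h" "h < b" for h
  proof -
    define c where "c = b / 2"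
    have c: "0 < c" "c < b" using b by (auto simp: c_def)
    have "(h / (h + c)) * f (- c) + (c / (h + c)) * f h \<le> f ((h / (h + c)) * (- c) + (c / (h + c)) * h)"
      using h c by (intro cv) (auto simp: add_divide_distrib [symmetric])
    moreover have "(h / (h + c)) * (- c) + (c / (h + c)) * h = 0"
      by (simp add: field_simps)
    ultimately have "(h * f (- c) + c * f h) / (h + c) \<le> f 0"
      by (simp add: add_divide_distrib)
    then have "h * f (- c) + c * f h \<le> f 0 * (h + c)"
      using h c by (simp add: pos_divide_le_eq)
    then show ?thesis
      unfolding q_def c_def[symmetric] using h c by (simp add: field_simps)
  qed
  have bdd: "bdd_above (q ` {0<..<b})"
    using bnd by (intro bdd_aboveI2) auto
  have "(q \<longlongrightarrow> (SUP h\<in>{0<..<b}. q h)) (at_right 0)"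
  proof (rule order_tendstoI)
    fix a assume "a < (SUP h\<in>{0<..<b}. q h)"
    then obtain k where k: "k \<in> {0<..<b}" "a < q k"
      using less_cSUP_iff[OF _ bdd] b by auto
    have "a < q h" if "0 < h" "h < k" for h
      using anti[of h k] that k by auto
    then show "\<forall>\<^sub>F h in at_right 0. a < q h"
      using k by (auto simp: eventually_at_right_field intro!: exI[of _ k])
  next
    fix a assume a: "(SUP h\<in>{0<..<b}. q h) < a"
    have "q h < a" if "0 < h" "h < b" for h
      using cSUP_upper[OF _ bdd, of h] that a by auto
    then show "\<forall>\<^sub>F h in at_right 0. q h < a"
      using b by (auto simp: eventually_at_right_field intro!: exI[of _ b])
  qed
  then show ?thesis
    unfolding q_def by blast
qed

lemma D_plus_min_value:
  assumes "Q \<noteq> {}" "\<And>x. x \<in> Q \<Longrightarrow> \<phi> x y \<ge> 0" "\<And>x. x \<in> Q \<Longrightarrow> \<psi> x \<ge> 0" and "\<alpha> > 0"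
  defines "F \<equiv> min_value Q \<phi> \<psi> y"
  shows "((\<lambda>h. (F \<alpha> - F (\<alpha> - h)) / h) \<longlongrightarrow> D_plus F \<alpha>) (at_right 0)"
proof -
  have F: "u * F s + v * F t \<le> F (u * s + v * t)"
    if "s > 0" "t > 0" "u \<ge> 0" "v \<ge> 0" "u + v = 1" for s t u v
    using concave_on_min_value[where Q = Q and \<phi> = \<phi> and \<psi> = \<psi> and y = y, OF assms(1-3)] that by (auto simp: concave_on_iff F_def)
  have "u * F (\<alpha> - s) + v * F (\<alpha> - t) \<le> F (\<alpha> - (u * s + v * t))"
    if "s \<in> {-\<alpha><..<\<alpha>}" "t \<in> {-\<alpha><..<\<alpha>}" "u \<ge> 0" "v \<ge> 0" "u + v = 1" for s t u v
  proof -
    have "u * (\<alpha> - s) + v * (\<alpha> - t) = (u + v) * \<alpha> - (u * s + v * t)"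
      by (simp add: algebra_simps)
    with F[of "\<alpha> - s" "\<alpha> - t" u v] that show ?thesis by simp
  qed
  then have "concave_on {-\<alpha><..<\<alpha>} (\<lambda>t. F (\<alpha> - t))"
    by (auto simp: concave_on_iff convex_real_interval)
  from concave_on_right_quotient[OF this \<open>\<alpha> > 0\<close>]
  obtain L where "((\<lambda>h. (F (\<alpha> - h) - F \<alpha>) / h) \<longlongrightarrow> L) (at_right 0)" by auto
  then have "((\<lambda>h. (F \<alpha> - F (\<alpha> - h)) / h) \<longlongrightarrow> - L) (at_right 0)"
    by (auto dest: tendsto_minus simp: minus_divide_left)
  then show ?thesis
    unfolding D_plus_def using tendsto_Lim[of "at_right (0::real)"] by fastforce
qed

lemma D_minus_min_value:
  assumes "Q \<noteq> {}" "\<And>x. x \<in> Q \<Longrightarrow> \<phi> x y \<ge> 0" "\<And>x. x \<in> Q \<Longrightarrow> \<psi> x \<ge> 0" and "\<alpha> > 0"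
  defines "F \<equiv> min_value Q \<phi> \<psi> y"
  shows "((\<lambda>h. (F (\<alpha> + h) - F \<alpha>) / h) \<longlongrightarrow> D_minus F \<alpha>) (at_right 0)"
proof -
  have F: "u * F s + v * F t \<le> F (u * s + v * t)"
    if "s > 0" "t > 0" "u \<ge> 0" "v \<ge> 0" "u + v = 1" for s t u v
    using concave_on_min_value[where Q = Q and \<phi> = \<phi> and \<psi> = \<psi> and y = y, OF assms(1-3)] that by (auto simp: concave_on_iff F_def)
  have "u * F (\<alpha> + s) + v * F (\<alpha> + t) \<le> F (\<alpha> + (u * s + v * t))"
    if "s \<in> {-\<alpha><..<\<alpha>}" "t \<in> {-\<alpha><..<\<alpha>}" "u \<ge> 0" "v \<ge> 0" "u + v = 1" for s t u v
  proof -
    have "u * (\<alpha> + s) + v * (\<alpha> + t) = (u + v) * \<alpha> + (u * s + v * t)"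
      by (simp add: algebra_simps)
    with F[of "\<alpha> + s" "\<alpha> + t" u v] that show ?thesis by simp
  qed
  then have "concave_on {-\<alpha><..<\<alpha>} (\<lambda>t. F (\<alpha> + t))"
    by (auto simp: concave_on_iff convex_real_interval)
  from concave_on_right_quotient[OF this \<open>\<alpha> > 0\<close>]
  obtain L where "((\<lambda>h. (F (\<alpha> + h) - F \<alpha>) / h) \<longlongrightarrow> L) (at_right 0)" by auto
  then show ?thesis
    unfolding D_minus_def using tendsto_Lim[of "at_right (0::real)"] by fastforce
qed

end

theory Submission
  imports Defs
begin

text \<open>
  The minimum value function \<open>F\<close> is an infimum of the affine functions
  \<open>\<beta> \<mapsto> \<phi> x y + \<beta> * \<psi> x\<close>, and a minimizer \<open>x\<close> at \<open>\<beta>\<close> is one whose affine function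
  touches the graph of \<open>F\<close> at \<open>\<beta>\<close>. So \<open>\<psi> x\<close> is the slope of a line that supports the concave
  function \<open>F\<close> from above at \<open>\<beta>\<close> (\<open>min_value_le_support_line\<close>). A minimizer at \<open>\<alpha>\<close> itself only
  gives some slope between the two one-sided derivatives, so the extreme slopes are reached by
  approaching \<open>\<alpha>\<close> from one side: for a minimizer \<open>x\<close> at \<open>\<alpha> + t\<close>, the number \<open>\<psi> x\<close> lies between
  the slopes of the chords of \<open>F\<close> over the two intervals with end points \<open>\<alpha>\<close>, \<open>\<alpha> + t\<close> and
  \<open>\<alpha> + t\<close>, \<open>\<alpha> + 2 * t\<close>. As \<open>t\<close> tends to \<open>0\<close> from one side, both chord slopes tend to the
  derivative of \<open>F\<close> from that side (\<open>minimizer_of_limiting_slope\<close>).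

  It remains to pass to the limit in the minimizers, which is the content of
  \<open>minimizer_of_limit\<close>. A weak limit \<open>l\<close> need not have \<open>\<psi> l\<close> equal to the limit \<open>d\<close> of the values
  of \<open>\<psi>\<close> by semicontinuity alone, which only yields \<open>\<psi> l \<le> d\<close>. But it also yields
  \<open>\<phi> l y \<le> F \<alpha> - \<alpha> * d\<close>, and since \<open>F \<alpha>\<close> is a lower bound of \<open>\<phi> l y + \<alpha> * \<psi> l\<close>, neither
  inequality can be strict.
\<close>

lemma wslsc_onD_tendsto:
  assumes "wslsc_on Q g" "\<And>n. x n \<in> Q" "l \<in> Q" "weakly_converges x l"
    and lim: "(\<lambda>n. g (x n)) \<longlonglongrightarrow> c"
  shows "g l \<le> c"
proof -
  have "ereal (g l) \<le> liminf (\<lambda>n. ereal (g (x n)))"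
    using assms unfolding wslsc_on_def by blast
  also have "\<dots> = ereal c"
    using lim by (intro lim_imp_Liminf) auto
  finally show ?thesis by simp
qed

lemma psi_bounded_if_tendsto:
  assumes "(\<lambda>n. \<psi> (x n)) \<longlonglongrightarrow> d"
  shows "psi_bounded \<psi> x"
proof -
  obtain K where K: "K > 0" "\<And>n. norm (\<psi> (x n)) \<le> K"
    using convergent_imp_Bseq[OF convergentI[OF assms]] by (auto simp: Bseq_def)
  then have "\<psi> (x n) \<le> K" for n
    using abs_le_D1 by auto
  then have "(SUP n. ereal (\<psi> (x n))) \<le> ereal K"
    by (intro SUP_least) auto
  also have "\<dots> < ereal (K + 1)" by simp
  finally show ?thesis
    using K(1) unfolding psi_bounded_def by (intro exI[of _ "K + 1"]) auto
qed

lemma min_value_le_objective: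
  assumes "\<And>x. x \<in> Q \<Longrightarrow> \<phi> x y \<ge> 0" "\<And>x. x \<in> Q \<Longrightarrow> \<psi> x \<ge> 0"
    and "\<alpha> \<ge> 0" "x \<in> Q"
  shows "min_value Q \<phi> \<psi> y \<alpha> \<le> objective \<phi> \<psi> y \<alpha> x"
proof -
  have "bdd_below (objective \<phi> \<psi> y \<alpha> ` Q)"
    using assms by (intro bdd_belowI2[where m = 0]) (auto simp: objective_def)
  then show ?thesis
    unfolding min_value_def using \<open>x \<in> Q\<close> by (rule cINF_lower)
qed

text \<open>
  The objective of a fixed \<open>x\<close> is affine in the parameter with slope \<open>\<psi> x\<close>, and it bounds
  \<open>min_value\<close> from above.
\<close>

lemma min_value_le_support_line:
  assumes "\<And>x. x \<in> Q \<Longrightarrow> \<phi> x y \<ge> 0" "\<And>x. x \<in> Q \<Longrightarrow> \<psi> x \<ge> 0"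
    and "\<gamma> \<ge> 0" and x: "x \<in> minimizers Q \<phi> \<psi> y \<beta>"
  shows "min_value Q \<phi> \<psi> y \<gamma> \<le> min_value Q \<phi> \<psi> y \<beta> + (\<gamma> - \<beta>) * \<psi> x"
proof -
  have "min_value Q \<phi> \<psi> y \<gamma> \<le> objective \<phi> \<psi> y \<gamma> x"
    using assms by (intro min_value_le_objective) (auto simp: minimizers_def)
  also have "\<dots> = objective \<phi> \<psi> y \<beta> x + (\<gamma> - \<beta>) * \<psi> x"
    by (simp add: objective_def algebra_simps)
  also have "objective \<phi> \<psi> y \<beta> x = min_value Q \<phi> \<psi> y \<beta>"
    using x by (simp add: minimizers_def)
  finally show ?thesis .
qed

text \<open>
  Convergence of \<open>\<psi>\<close> and of the minimum values forces \<open>\<phi>\<close> to converge along the minimizers as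
  well, to \<open>F \<alpha> - \<alpha> * d\<close>. Semicontinuity then bounds each of the two terms of the objective at a
  weak limit, and minimality turns both bounds into equalities.
\<close>

lemma minimizer_of_limit:
  fixes Q :: "'a::real_normed_vector set"
  assumes nonneg: "\<And>x. x \<in> Q \<Longrightarrow> \<phi> x y \<ge> 0" "\<And>x. x \<in> Q \<Longrightarrow> \<psi> x \<ge> 0"
    and compactness: "\<And>x :: nat \<Rightarrow> 'a. (\<forall>n. x n \<in> Q) \<Longrightarrow> psi_bounded \<psi> x \<Longrightarrow>
          \<exists>r l. strict_mono r \<and> l \<in> Q \<and> weakly_converges (x \<circ> r) l"
    and lsc: "wslsc_on Q (\<lambda>x. \<phi> x y)" "wslsc_on Q \<psi>"
    and x: "\<And>n. x n \<in> minimizers Q \<phi> \<psi> y (a n)"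
    and a: "a \<longlonglongrightarrow> \<alpha>" "\<alpha> > 0"
    and F: "(\<lambda>n. min_value Q \<phi> \<psi> y (a n)) \<longlonglongrightarrow> min_value Q \<phi> \<psi> y \<alpha>"
    and d: "(\<lambda>n. \<psi> (x n)) \<longlonglongrightarrow> d"
  shows "\<exists>l \<in> minimizers Q \<phi> \<psi> y \<alpha>. \<psi> l = d"
proof -
  have xQ: "x n \<in> Q" for n
    using x[of n] by (simp add: minimizers_def)
  obtain r l where r: "strict_mono r" and l: "l \<in> Q" and wl: "weakly_converges (x \<circ> r) l"
    using compactness[of x] psi_bounded_if_tendsto[of \<psi> x, OF d] xQ by blast
  have "\<phi> (x n) y = min_value Q \<phi> \<psi> y (a n) - a n * \<psi> (x n)" for n
    using x[of n] by (simp add: minimizers_def objective_def)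
  then have "(\<lambda>n. \<phi> (x n) y) \<longlonglongrightarrow> min_value Q \<phi> \<psi> y \<alpha> - \<alpha> * d"
    using tendsto_diff[OF F tendsto_mult[OF a(1) d]] by simp
  then have \<phi>_le: "\<phi> l y \<le> min_value Q \<phi> \<psi> y \<alpha> - \<alpha> * d"
    using LIMSEQ_subseq_LIMSEQ[OF _ r] xQ
    by (intro wslsc_onD_tendsto[OF lsc(1) _ l wl]) (auto simp: o_def)
  have \<psi>_le: "\<psi> l \<le> d"
    using LIMSEQ_subseq_LIMSEQ[OF d r] xQ
    by (intro wslsc_onD_tendsto[OF lsc(2) _ l wl]) (auto simp: o_def)
  have ge: "min_value Q \<phi> \<psi> y \<alpha> \<le> \<phi> l y + \<alpha> * \<psi> l"
    using min_value_le_objective[of Q \<phi> y \<psi> \<alpha> l] nonneg a(2) l by (simp add: objective_def)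
  have "\<alpha> * d \<le> \<alpha> * \<psi> l"
    using \<phi>_le ge by linarith
  then have "\<psi> l = d"
    using \<psi>_le a(2) by simp
  moreover have "l \<in> minimizers Q \<phi> \<psi> y \<alpha>"
    using \<phi>_le ge l \<open>\<psi> l = d\<close> by (simp add: minimizers_def objective_def)
  ultimately show ?thesis by blast
qed

text \<open>
  Signed increments \<open>t n\<close> cover both one-sided derivatives at once. The slopes at \<open>2 * t n\<close> are
  needed because the chord from \<open>\<alpha>\<close> to \<open>\<alpha> + t n\<close> bounds \<open>\<psi>\<close> at a minimizer for \<open>\<alpha> + t n\<close> on one
  side only; the opposite bound comes from the next chord of the same length.
\<close>

lemma minimizer_of_limiting_slope:
  fixes Q :: "'a::real_normed_vector set"
  assumes nonneg: "\<And>x. x \<in> Q \<Longrightarrow> \<phi> x y \<ge> 0" "\<And>x. x \<in> Q \<Longrightarrow> \<psi> x \<ge> 0"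
    and minimizers_nonempty: "\<And>\<beta>. \<beta> > 0 \<Longrightarrow> minimizers Q \<phi> \<psi> y \<beta> \<noteq> {}"
    and compactness: "\<And>x :: nat \<Rightarrow> 'a. (\<forall>n. x n \<in> Q) \<Longrightarrow> psi_bounded \<psi> x \<Longrightarrow>
          \<exists>r l. strict_mono r \<and> l \<in> Q \<and> weakly_converges (x \<circ> r) l"
    and lsc: "wslsc_on Q (\<lambda>x. \<phi> x y)" "wslsc_on Q \<psi>"
    and \<alpha>: "\<alpha> > 0"
    and t: "t \<longlonglongrightarrow> 0" "\<And>n. t n \<noteq> 0" "\<And>n. \<alpha> + 2 * t n > 0"
  defines "slope \<equiv> \<lambda>t. (min_value Q \<phi> \<psi> y (\<alpha> + t) - min_value Q \<phi> \<psi> y \<alpha>) / t"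
  assumes slope: "(\<lambda>n. slope (t n)) \<longlonglongrightarrow> d" "(\<lambda>n. slope (2 * t n)) \<longlonglongrightarrow> d"
  shows "\<exists>l \<in> minimizers Q \<phi> \<psi> y \<alpha>. \<psi> l = d"
proof -
  define F where "F = min_value Q \<phi> \<psi> y"
  have pos: "\<alpha> + t n > 0" for n
    using t(3)[of n] \<alpha> by linarith
  then have "\<forall>n. \<exists>z. z \<in> minimizers Q \<phi> \<psi> y (\<alpha> + t n)"
    using minimizers_nonempty by blast
  then obtain x where x: "\<And>n. x n \<in> minimizers Q \<phi> \<psi> y (\<alpha> + t n)"
    by (meson choice)
  \<comment> \<open>The slope of the chord from \<open>\<alpha> + t n\<close> to \<open>\<alpha> + 2 * t n\<close>.\<close>
  define c where "c n = 2 * slope (2 * t n) - slope (t n)" for n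
  have c: "c n = (F (\<alpha> + 2 * t n) - F (\<alpha> + t n)) / t n" for n
    using t(2)[of n] by (simp add: c_def slope_def F_def field_simps)
  have c_lim: "c \<longlonglongrightarrow> d"
    unfolding c_def using tendsto_diff[OF tendsto_mult_left[OF slope(2), of 2] slope(1)] by simp
  have between: "min (slope (t n)) (c n) \<le> \<psi> (x n) \<and> \<psi> (x n) \<le> max (slope (t n)) (c n)" for n
  proof -
    have F0: "F \<alpha> \<le> F (\<alpha> + t n) - t n * \<psi> (x n)"
      using min_value_le_support_line[of Q \<phi> y \<psi> \<alpha>, OF nonneg _ x[of n]] \<alpha>
      by (simp add: F_def)
    have F2: "F (\<alpha> + 2 * t n) \<le> F (\<alpha> + t n) + t n * \<psi> (x n)"
      using min_value_le_support_line[of Q \<phi> y \<psi> "\<alpha> + 2 * t n", OF nonneg _ x[of n]] t(3)[of n]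
      by (simp add: F_def)
    show ?thesis
    proof (cases "t n > 0")
      case True
      then have "\<psi> (x n) \<le> slope (t n)" "c n \<le> \<psi> (x n)"
        using F0 F2 by (auto simp: slope_def c F_def[symmetric] field_simps)
      then show ?thesis by auto
    next
      case False
      then have "t n < 0"
        using t(2)[of n] by simp
      then have "slope (t n) \<le> \<psi> (x n)" "\<psi> (x n) \<le> c n"
        using F0 F2 by (auto simp: slope_def c F_def[symmetric] field_simps)
      then show ?thesis by auto
    qed
  qed
  have "(\<lambda>n. \<psi> (x n)) \<longlonglongrightarrow> d"
  proof (rule tendsto_sandwich)
    show "(\<lambda>n. min (slope (t n)) (c n)) \<longlonglongrightarrow> d" "(\<lambda>n. max (slope (t n)) (c n)) \<longlonglongrightarrow> d"
      using tendsto_min[OF slope(1) c_lim] tendsto_max[OF slope(1) c_lim] by auto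
  qed (use between in auto)
  moreover have "(\<lambda>n. F (\<alpha> + t n)) \<longlonglongrightarrow> F \<alpha>"
  proof -
    have "F (\<alpha> + t n) = F \<alpha> + t n * slope (t n)" for n
      using t(2)[of n] by (simp add: slope_def F_def)
    then show ?thesis
      using tendsto_add[OF tendsto_const tendsto_mult[OF t(1) slope(1)], of "F \<alpha>"] by simp
  qed
  moreover have "(\<lambda>n. \<alpha> + t n) \<longlonglongrightarrow> \<alpha>"
    using tendsto_add[OF tendsto_const t(1), of \<alpha>] by simp
  ultimately show ?thesis
    using minimizer_of_limit[of Q \<phi> y \<psi> x "\<lambda>n. \<alpha> + t n", OF nonneg compactness lsc x] \<alpha>
    by (simp add: F_def)
qed

theorem theorem1:
  fixes Q_ad :: "'a::banach set"
    and y\<delta> :: "'b::banach"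
    and \<phi> :: "'a \<Rightarrow> 'b \<Rightarrow> real"
    and \<psi> :: "'a \<Rightarrow> real"
  assumes nonempty: "Q_ad \<noteq> {}"
    and \<phi>_nonneg: "\<And>x. x \<in> Q_ad \<Longrightarrow> \<phi> x y\<delta> \<ge> 0"
    and \<psi>_nonneg: "\<And>x. x \<in> Q_ad \<Longrightarrow> \<psi> x \<ge> 0"
    and minimizers_nonempty: "\<And>\<alpha>. \<alpha> > 0 \<Longrightarrow> minimizers Q_ad \<phi> \<psi> y\<delta> \<alpha> \<noteq> {}"
    and compactness: "\<And>x :: nat \<Rightarrow> 'a. (\<forall>n. x n \<in> Q_ad) \<Longrightarrow> psi_bounded \<psi> x \<Longrightarrow>
          \<exists>r l. strict_mono r \<and> l \<in> Q_ad \<and> weakly_converges (x \<circ> r) l"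
    and \<phi>_lsc: "wslsc_on Q_ad (\<lambda>x. \<phi> x y\<delta>)"
    and \<psi>_lsc: "wslsc_on Q_ad \<psi>"
  shows "\<forall>\<alpha>>0. \<exists>x_plus \<in> minimizers Q_ad \<phi> \<psi> y\<delta> \<alpha>. \<exists>x_minus \<in> minimizers Q_ad \<phi> \<psi> y\<delta> \<alpha>.
           \<psi> x_plus = D_plus (min_value Q_ad \<phi> \<psi> y\<delta>) \<alpha> \<and>
           \<psi> x_minus = D_minus (min_value Q_ad \<phi> \<psi> y\<delta>) \<alpha>"
proof (intro allI impI)
  fix \<alpha> :: real
  assume \<alpha>: "\<alpha> > 0"
  define F where "F = min_value Q_ad \<phi> \<psi> y\<delta>"
  note limiting_slope = minimizer_of_limiting_slope[of Q_ad \<phi> y\<delta> \<psi>,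
      OF \<phi>_nonneg \<psi>_nonneg minimizers_nonempty compactness \<phi>_lsc \<psi>_lsc \<alpha>,
      folded F_def]
  \<comment> \<open>Since \<open>h n \<le> \<alpha> / 3\<close>, the point \<open>\<alpha> - 2 * h n\<close> still lies in the domain of \<open>F\<close>.\<close>
  define h :: "nat \<Rightarrow> real" where "h n = \<alpha> / 3 * inverse (Suc n)" for n
  have h_pos: "h n > 0" for n
    using \<alpha> by (simp add: h_def)
  have h_less: "2 * h n < \<alpha>" for n
  proof -
    have "h n \<le> \<alpha> / 3 * 1"
      unfolding h_def using \<alpha> by (intro mult_left_mono) (auto simp: field_simps)
    then show ?thesis using \<alpha> by linarith
  qed
  have h_lim: "h \<longlonglongrightarrow> 0"
    unfolding h_def using tendsto_mult_left[OF LIMSEQ_inverse_real_of_nat, of "\<alpha> / 3"] by simp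
  have h_right: "filterlim h (at_right 0) sequentially"
    using h_lim h_pos by (simp add: filterlim_at less_imp_neq[OF h_pos, symmetric])
  have h2_right: "filterlim (\<lambda>n. 2 * h n) (at_right 0) sequentially"
    using tendsto_mult_left[OF h_lim, of 2] h_pos
    by (simp add: filterlim_at less_imp_neq[OF h_pos, symmetric])

  have plus: "((\<lambda>h. (F (\<alpha> + - h) - F \<alpha>) / - h) \<longlongrightarrow> D_plus F \<alpha>) (at_right 0)"
    using D_plus_min_value[of Q_ad \<phi> y\<delta> \<psi> \<alpha>, OF nonempty \<phi>_nonneg \<psi>_nonneg \<alpha>, folded F_def]
    by (simp add: minus_divide_left)
  have "\<exists>l \<in> minimizers Q_ad \<phi> \<psi> y\<delta> \<alpha>. \<psi> l = D_plus F \<alpha>"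
  proof (rule limiting_slope[where t = "\<lambda>n. - h n"])
    show "(\<lambda>n. - h n) \<longlonglongrightarrow> 0"
      using tendsto_minus[OF h_lim] by simp
    show "- h n \<noteq> 0" "\<alpha> + 2 * - h n > 0" for n
      using h_pos[of n] h_less[of n] by auto
    show "(\<lambda>n. (F (\<alpha> + - h n) - F \<alpha>) / - h n) \<longlonglongrightarrow> D_plus F \<alpha>"
      using filterlim_compose[OF plus h_right] .
    show "(\<lambda>n. (F (\<alpha> + 2 * - h n) - F \<alpha>) / (2 * - h n)) \<longlonglongrightarrow> D_plus F \<alpha>"
      using filterlim_compose[OF plus h2_right] by simp
  qed
  moreover
  have minus: "((\<lambda>h. (F (\<alpha> + h) - F \<alpha>) / h) \<longlongrightarrow> D_minus F \<alpha>) (at_right 0)"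
    using D_minus_min_value[of Q_ad \<phi> y\<delta> \<psi> \<alpha>, OF nonempty \<phi>_nonneg \<psi>_nonneg \<alpha>, folded F_def] .
  have "\<exists>l \<in> minimizers Q_ad \<phi> \<psi> y\<delta> \<alpha>. \<psi> l = D_minus F \<alpha>"
  proof (rule limiting_slope[where t = h])
    show "h \<longlonglongrightarrow> 0" by (rule h_lim)
    show "h n \<noteq> 0" "\<alpha> + 2 * h n > 0" for n
      using h_pos[of n] \<alpha> by auto
    show "(\<lambda>n. (F (\<alpha> + h n) - F \<alpha>) / h n) \<longlonglongrightarrow> D_minus F \<alpha>"
      using filterlim_compose[OF minus h_right] .
    show "(\<lambda>n. (F (\<alpha> + 2 * h n) - F \<alpha>) / (2 * h n)) \<longlonglongrightarrow> D_minus F \<alpha>"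
      using filterlim_compose[OF minus h2_right] .
  qed
  ultimately show "\<exists>x_plus \<in> minimizers Q_ad \<phi> \<psi> y\<delta> \<alpha>. \<exists>x_minus \<in> minimizers Q_ad \<phi> \<psi> y\<delta> \<alpha>.
      \<psi> x_plus = D_plus (min_value Q_ad \<phi> \<psi> y\<delta>) \<alpha> \<and>
      \<psi> x_minus = D_minus (min_value Q_ad \<phi> \<psi> y\<delta>) \<alpha>"
    unfolding F_def by blast
qed

end
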